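(* Let $\mathcal{B}$ be the Borel $\sigma$-algebra on $\mathbb{R}$, $\lambda$ the Lebesgue measure, and define $\Phi(A)=\lambda(\{\mathrm{fr}(a): a\in A\})$ for $A\in\mathcal{B}$, where $\mathrm{fr}(a)$ is the fractional part of $a$. Then $\Phi$ is a coverage function on $(\mathbb{R},\mathcal{B})$ with $\Phi(\mathbb{R})=1$, and for every positive integer $q$ and every coverage function $\psi\colon 2^{[q]}\to\mathbb{R}$ with $\psi([q])=1$ there is a partition $Q_1,\dots,Q_q$ of $\mathbb{R}$ into Borel sets with $\psi(I)=\Phi(\bigcup_{i\in I}Q_i)$ for all $I\subseteq[q]$.
   Context: A function $\varphi$ on a set algebra $(J,\mathcal{B})$ is a coverage function if $\varphi(\emptyset)=0$ and for every positive integer $k$ and all $A_0,A_1,\dots,A_k\in\mathcal{B}$: $\sum_{K\subseteq[k]}(-1)^{|K|}\varphi(A_0\cup\bigcup_{i\in K}A_i)\le 0$. On a finite ground set this is equivalent to $\varphi(X)=\sum_{t\in N(X)}w_t$ for some bipartite graph $G=(S,T;E)$ and weights $w\in\mathbb{R}_+^T$. *)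

theory Defs
  imports "HOL-Analysis.Analysis"
begin

definition coverage_function :: "'a set \<Rightarrow> 'a set set \<Rightarrow> ('a set \<Rightarrow> real) \<Rightarrow> bool" where
  "coverage_function J B \<phi> \<longleftrightarrow>
     algebra J B \<and> \<phi> {} = 0 \<and>
     (\<forall>k::nat. k \<ge> 1 \<longrightarrow> (\<forall>A :: nat \<Rightarrow> 'a set. (\<forall>i\<le>k. A i \<in> B) \<longrightarrow>
        (\<Sum>K\<in>Pow {1..k}. (- 1) ^ card K * \<phi> (A 0 \<union> (\<Union>i\<in>K. A i))) \<le> 0))"

(* For a Borel set A, the image frac ` A is the countable union over the integers n of the
   translates of A \<inter> {n..<n + 1} by - n, hence again a Borel set; and it lies in {0..<1}, so
   the real-valued measure below is its actual Lebesgue measure. *)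
definition Phi :: "real set \<Rightarrow> real" where
  "Phi A = measure lebesgue (frac ` A)"

end

theory Submission
  imports Defs
begin

text \<open>
  The alternating sum of \<open>\<mu>(B\<^sub>0 \<union> \<Union>\<^sub>K B)\<close> equals \<open>- \<mu>(\<Inter>B - B\<^sub>0)\<close>, so the measure of the
  image under the fractional part is a coverage function. Conversely, Moebius inversion turns a
  coverage function \<open>\<psi>\<close> on \<open>V = {1..q}\<close> into weights \<open>w S \<ge> 0\<close> of the nonempty sets
  \<open>S \<subseteq> V\<close>, with \<open>\<psi> I\<close> the total weight of the \<open>S\<close> that meet \<open>I\<close>. Cut
  \<open>[0,1)\<close> into intervals of lengths \<open>w S\<close>. Each fractional part in the interval of \<open>S\<close> has
  infinitely many preimages, one in every \<open>[n, n+1)\<close>; the one with \<open>n = i\<close> goes to \<open>Q\<^sub>i\<close> if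
  \<open>i \<in> S\<close>, and all others go to some \<open>Q\<^sub>j\<close> with \<open>j \<in> S\<close>.
\<close>

section \<open>Alternating sums over power sets\<close>

lemma sum_alternating_Pow_insert:
  fixes f :: "'a set \<Rightarrow> 'b::ring_1"
  assumes "finite N" "a \<notin> N"
  shows "(\<Sum>K\<in>Pow (insert a N). (- 1) ^ card K * f K) =
    (\<Sum>K\<in>Pow N. (- 1) ^ card K * f K) - (\<Sum>K\<in>Pow N. (- 1) ^ card K * f (insert a K))"
proof -
  have "card (insert a K) = Suc (card K)" if "K \<in> Pow N" for K
    using that assms by (metis PowD card_insert_disjoint finite_subset subsetD)
  moreover have "inj_on (insert a) (Pow N)"
    using assms(2) by (intro inj_onI) (metis PowD insert_ident subsetD)
  ultimately have "(\<Sum>K\<in>insert a ` Pow N. (- 1) ^ card K * f K) =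
      - (\<Sum>K\<in>Pow N. (- 1) ^ card K * f (insert a K))"
    by (simp add: sum.reindex sum_negf)
  moreover have "(\<Sum>K\<in>Pow (insert a N). (- 1) ^ card K * f K) =
      (\<Sum>K\<in>Pow N. (- 1) ^ card K * f K) + (\<Sum>K\<in>insert a ` Pow N. (- 1) ^ card K * f K)"
    unfolding Pow_insert by (rule sum.union_disjoint) (use assms in auto)
  ultimately show ?thesis by simp
qed

text \<open>Inserting \<open>a\<close> splits the sum into its instances at \<open>B0\<close> and at
  \<open>B0 \<union> B a\<close>, which is why \<open>B0\<close> must vary in the induction. Their
  difference is minus the measure of the part of the intersection outside \<open>B0\<close> that
  lies in \<open>B a\<close>.\<close>

lemma sum_alternating_measure_Un:
  assumes "finite N" "N \<noteq> {}" "B0 \<in> fmeasurable M" "\<And>i. i \<in> N \<Longrightarrow> B i \<in> fmeasurable M"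
  shows "(\<Sum>K\<in>Pow N. (- 1) ^ card K * measure M (B0 \<union> (\<Union>i\<in>K. B i))) =
    - measure M ((\<Inter>i\<in>N. B i) - B0)"
  using assms
proof (induction N arbitrary: B0 rule: finite_ne_induct)
  case (singleton a)
  then show ?case
    by (simp add: Pow_insert measure_Un2)
next
  case (insert a N)
  let ?I = "\<Inter>i\<in>N. B i"
  have B: "B0 \<in> sets M" "B a \<in> sets M" "?I \<in> sets M"
    using insert.prems insert.hyps by (simp_all add: fmeasurableD sets.finite_INT)
  have Ba: "B0 \<union> B a \<in> fmeasurable M"
    using insert.prems by (simp add: fmeasurable.Un)
  have I: "?I \<in> fmeasurable M"
  proof -
    obtain i where i: "i \<in> N" using insert.hyps by auto
    then have "B i \<in> fmeasurable M" "?I \<subseteq> B i"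
      using insert.prems by auto
    then show ?thesis
      using B(3) by (rule fmeasurableI2)
  qed
  have "(\<Sum>K\<in>Pow (insert a N). (- 1) ^ card K * measure M (B0 \<union> (\<Union>i\<in>K. B i))) =
      - measure M (?I - B0) + measure M (?I - (B0 \<union> B a))"
    using insert.IH[OF insert.prems(1)] insert.IH[OF Ba] insert.prems insert.hyps
    by (simp add: sum_alternating_Pow_insert Un_assoc)
  also have "measure M (?I - B0) =
      measure M ((?I \<inter> B a - B0) \<union> (?I - (B0 \<union> B a)))"
    by (rule arg_cong[where f = "measure M"]) auto
  also have "\<dots> = measure M (?I \<inter> B a - B0) + measure M (?I - (B0 \<union> B a))"
  proof (rule measure_Union)
    have "?I \<inter> B a - B0 \<in> fmeasurable M" "?I - (B0 \<union> B a) \<in> fmeasurable M"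
      by (rule fmeasurableI2[OF I], use B in auto)+
    then show "?I \<inter> B a - B0 \<in> sets M" "?I - (B0 \<union> B a) \<in> sets M"
      "emeasure M (?I \<inter> B a - B0) \<noteq> \<infinity>" "emeasure M (?I - (B0 \<union> B a)) \<noteq> \<infinity>"
      by (simp_all add: fmeasurableD fmeasurableD2)
  qed auto
  finally show ?case
    by (simp add: Int_commute)
qed

section \<open>Fractional parts and the coverage property of \<open>Phi\<close>\<close>

lemma borel_measurable_frac [measurable]: "frac \<in> borel_measurable (borel :: real measure)"
  unfolding frac_def by measurable

text \<open>Borel maps need not have Borel images in general; here the image splits by the integer
  part \<open>n\<close> into countably many pieces, each a translate of a part of
  \<open>A\<close>.\<close>

lemma frac_image_borel:
  fixes A :: "real set"
  assumes [measurable]: "A \<in> sets borel"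
  shows "frac ` A \<in> sets borel"
proof -
  have "frac ` A = (\<Union>n::int. {t. 0 \<le> t \<and> t < 1 \<and> t + real_of_int n \<in> A})"
  proof (intro equalityI subsetI)
    fix t assume "t \<in> frac ` A"
    then obtain x where "x \<in> A" "t = frac x" by auto
    then show "t \<in> (\<Union>n::int. {t. 0 \<le> t \<and> t < 1 \<and> t + real_of_int n \<in> A})"
      by (auto intro!: exI[of _ "\<lfloor>x\<rfloor>"] simp: frac_lt_1) (simp add: frac_def)
  next
    fix t assume "t \<in> (\<Union>n::int. {t. 0 \<le> t \<and> t < 1 \<and> t + real_of_int n \<in> A})"
    then obtain n :: int where "0 \<le> t" "t < 1" "t + real_of_int n \<in> A" by auto
    then show "t \<in> frac ` A"
      by (metis frac_add_of_int_right frac_eq image_eqI)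
  qed
  also have "\<dots> \<in> sets borel"
    by measurable
  finally show ?thesis .
qed

lemma frac_image_fmeasurable:
  fixes A :: "real set"
  assumes "A \<in> sets borel"
  shows "frac ` A \<in> fmeasurable lebesgue"
proof (rule fmeasurableI2)
  show "{0..1::real} \<in> fmeasurable lebesgue"
    by simp
  show "frac ` A \<subseteq> {0..1}"
    by (auto simp: frac_lt_1 less_imp_le)
  show "frac ` A \<in> sets lebesgue"
    using frac_image_borel[OF assms] by (simp add: sets_completionI_sets)
qed

lemma coverage_function_Phi: "coverage_function UNIV (sets borel) Phi"
  unfolding coverage_function_def
proof (intro conjI allI impI)
  show "algebra (UNIV::real set) (sets borel)"
    using sets.algebra_axioms[of "borel :: real measure"] by simp
  show "Phi {} = 0"
    by (simp add: Phi_def)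
  fix k :: nat and A :: "nat \<Rightarrow> real set"
  assume k: "1 \<le> k" and A: "\<forall>i\<le>k. A i \<in> sets borel"
  have "(\<Sum>K\<in>Pow {1..k}. (- 1) ^ card K * Phi (A 0 \<union> (\<Union>i\<in>K. A i))) =
      - measure lebesgue ((\<Inter>i\<in>{1..k}. frac ` A i) - frac ` A 0)"
    \<comment> \<open>Images commute with unions, so the identity for measures applies to the sets
      of fractional parts; the intersection is taken of the images, not of the
      \<open>A i\<close>.\<close>
    unfolding Phi_def image_Un image_UN
    using k A by (intro sum_alternating_measure_Un) (auto intro: frac_image_fmeasurable)
  then show "(\<Sum>K\<in>Pow {1..k}. (- 1) ^ card K * Phi (A 0 \<union> (\<Union>i\<in>K. A i))) \<le> 0"
    by simp
qed

lemma Phi_UNIV: "Phi UNIV = 1"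
proof -
  have "range frac = {0..<1::real}"
    by (auto simp: frac_lt_1 image_iff intro!: bexI frac_eq_id[symmetric])
  then show ?thesis
    by (simp add: Phi_def)
qed

section \<open>Moebius inversion of coverage functions\<close>

text \<open>Enumerating \<open>N\<close> carries the inequality from \<open>{1..k}\<close> to any
  finite nonempty index set, so that a set of points can later index its own singletons. Slot 0 of
  \<open>A'\<close> holds \<open>A0\<close>.\<close>

lemma coverage_function_sum_nonpos:
  assumes "coverage_function J B \<phi>" "finite N" "N \<noteq> {}" "A0 \<in> B" "\<And>i. i \<in> N \<Longrightarrow> A i \<in> B"
  shows "(\<Sum>K\<in>Pow N. (- 1) ^ card K * \<phi> (A0 \<union> (\<Union>i\<in>K. A i))) \<le> 0"
proof -
  let ?k = "card N"
  obtain e where e: "bij_betw e {1..?k} N"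
    using ex_bij_betw_nat_finite_1[OF assms(2)] by auto
  define A' where "A' i = (if i = 0 then A0 else A (e i))" for i :: nat
  have k: "?k \<ge> 1"
    using assms(2,3) by (simp add: Suc_le_eq card_gt_0_iff)
  have A': "A' i \<in> B" if "i \<le> ?k" for i
    using that assms(4,5) bij_betwE[OF e] by (auto simp: A'_def)
  have "(\<Sum>K\<in>Pow N. (- 1) ^ card K * \<phi> (A0 \<union> (\<Union>i\<in>K. A i))) =
      (\<Sum>K\<in>Pow {1..?k}. (- 1) ^ card K * \<phi> (A' 0 \<union> (\<Union>i\<in>K. A' i)))"
  proof (rule sum.reindex_bij_betw[OF bij_betw_Pow[OF e], symmetric, THEN trans], rule sum.cong)
    fix K assume K: "K \<in> Pow {1..?k}"
    then have "inj_on e K"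
      using e by (meson PowD bij_betw_imp_inj_on inj_on_subset)
    moreover have "(\<Union>i\<in>e ` K. A i) = (\<Union>i\<in>K. A' i)"
      using K by (force simp: A'_def)
    ultimately show "(- 1) ^ card (e ` K) * \<phi> (A0 \<union> (\<Union>i\<in>e ` K. A i)) =
        (- 1) ^ card K * \<phi> (A' 0 \<union> (\<Union>i\<in>K. A' i))"
      by (simp add: card_image A'_def)
  qed simp
  also have "\<dots> \<le> 0"
    using assms(1) k A' unfolding coverage_function_def by blast
  finally show ?thesis .
qed

text \<open>The sets that miss \<open>I\<close> are the subsets of \<open>V - I\<close>. Passing to
  complements thus gives sums over full power sets, which Moebius inversion can handle.\<close>

lemma coverage_function_weights:
  assumes cov: "coverage_function V (Pow V) \<psi>" and fin: "finite V"
  obtains w where "\<And>S. S \<subseteq> V \<Longrightarrow> S \<noteq> {} \<Longrightarrow> w S \<ge> (0::real)"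
    and "\<And>I. I \<subseteq> V \<Longrightarrow> \<psi> I = (\<Sum>S | S \<subseteq> V \<and> S \<inter> I \<noteq> {}. w S)"
proof -
  define g where "g S = (\<Sum>L\<in>Pow S. (- 1) ^ card L * \<psi> (V - L))" for S
  define w where "w S = - ((- 1) ^ card S * g S)" for S
  have inv: "\<psi> (V - S) = - (\<Sum>T\<in>Pow S. w T)" if "S \<subseteq> V" for S
    using inclusion_exclusion_symmetric[of g "\<lambda>L. \<psi> (V - L)" S] finite_subset[OF that fin]
    by (simp add: g_def w_def sum_negf)
  show thesis
  proof
    fix S assume S: "S \<subseteq> V" "S \<noteq> {}"
    have finS: "finite S"
      using S fin finite_subset by blast
    have "- w S = (\<Sum>L\<in>Pow S. (- 1) ^ card (S - L) * \<psi> (V - L))"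
      unfolding w_def g_def minus_minus sum_distrib_left
    proof (rule sum.cong)
      fix L assume L: "L \<in> Pow S"
      then have "card S + card L = card (S - L) + 2 * card L"
        using finS card_mono[of S L] by (simp add: card_Diff_subset finite_subset)
      then have "(- 1 :: real) ^ card S * (- 1) ^ card L = (- 1) ^ (card (S - L) + 2 * card L)"
        by (metis power_add)
      then show "(- 1) ^ card S * ((- 1) ^ card L * \<psi> (V - L)) = (- 1) ^ card (S - L) * \<psi> (V - L)"
        by (simp add: power_add flip: mult.assoc)
    qed simp
    \<comment> \<open>With \<open>K = S - L\<close> one has
      \<open>V - L = (V - S) \<union> K\<close>, so this is the coverage expression for the base set
      \<open>V - S\<close> and the singletons of \<open>S\<close>.\<close>
    also have "\<dots> = (\<Sum>K\<in>Pow S. (- 1) ^ card K * \<psi> ((V - S) \<union> (\<Union>i\<in>K. {i})))"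
      using S by (intro sum.reindex_bij_witness[of _ "\<lambda>K. S - K" "\<lambda>L. S - L"])
        (auto simp: double_diff intro!: arg_cong[where f = \<psi>])
    also have "\<dots> \<le> 0"
      using S finS by (intro coverage_function_sum_nonpos[OF cov]) auto
    finally show "w S \<ge> 0" by simp
  next
    fix I assume I: "I \<subseteq> V"
    have "\<psi> {} = 0"
      using cov by (simp add: coverage_function_def)
    \<comment> \<open>The total vanishes because it includes \<open>w {} = - \<psi> V\<close>. Hence
      the sets that meet \<open>I\<close> weigh minus what those that miss it weigh.\<close>
    then have "sum w (Pow V) = 0"
      using inv[of V] by simp
    moreover have "\<psi> I = - sum w (Pow (V - I))"
      using inv[of "V - I"] I by (simp add: double_diff)
    moreover have "sum w (Pow V - Pow (V - I)) = sum w (Pow V) - sum w (Pow (V - I))"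
      using fin by (intro sum_diff) auto
    moreover have "Pow V - Pow (V - I) = {S. S \<subseteq> V \<and> S \<inter> I \<noteq> {}}"
      by auto
    ultimately show "\<psi> I = (\<Sum>S | S \<subseteq> V \<and> S \<inter> I \<noteq> {}. w S)"
      by simp
  qed
qed

section \<open>Construction of the Borel partition\<close>

text \<open>Intervals of lengths \<open>w a\<close> are laid end to end. The selector is total on
  the reals: each new element takes the whole ray from \<open>W\<close> on, and the window
  \<open>{0..<sum w F}\<close> cuts it to the right length.\<close>

lemma borel_selector_with_lengths:
  fixes w :: "'a \<Rightarrow> real"
  assumes "finite F" "F \<noteq> {}" "\<And>a. a \<in> F \<Longrightarrow> w a \<ge> 0"
  shows "\<exists>s :: real \<Rightarrow> 'a. (\<forall>t. s t \<in> F) \<and>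
    (\<forall>a\<in>F. s -` {a} \<in> sets borel \<and> measure lebesgue ({0..<sum w F} \<inter> s -` {a}) = w a)"
  using assms
proof (induction F rule: finite_ne_induct)
  case (singleton a)
  then show ?case
    by (intro exI[of _ "\<lambda>_. a"]) simp
next
  case (insert a F)
  define W where "W = sum w F"
  have sum_insert: "sum w (insert a F) = W + w a"
    using insert.hyps by (simp add: W_def)
  have "\<And>b. b \<in> F \<Longrightarrow> w b \<ge> 0"
    using insert.prems by simp
  from insert.IH[OF this, folded W_def] obtain s :: "real \<Rightarrow> 'a" where "(\<forall>t. s t \<in> F) \<and>
    (\<forall>b\<in>F. s -` {b} \<in> sets borel \<and> measure lebesgue ({0..<W} \<inter> s -` {b}) = w b)" ..
  then have s: "\<And>t. s t \<in> F" "\<And>b. b \<in> F \<Longrightarrow> s -` {b} \<in> sets borel"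
    "\<And>b. b \<in> F \<Longrightarrow> measure lebesgue ({0..<W} \<inter> s -` {b}) = w b"
    by blast+
  have W: "0 \<le> W" "0 \<le> w a"
    using insert.prems by (simp_all add: W_def sum_nonneg)
  define s' where "s' t = (if t < W then s t else a)" for t
  have "s t \<noteq> a" for t
    using s(1)[of t] insert.hyps by auto
  then have s'_a: "s' t = a \<longleftrightarrow> W \<le> t" for t
    by (simp add: s'_def not_less)
  have s'_b: "s' t = b \<longleftrightarrow> t < W \<and> s t = b" if "b \<in> F" for b t
  proof -
    have "a \<noteq> b" using that insert.hyps by auto
    then show ?thesis by (simp add: s'_def)
  qed
  have a: "s' -` {a} = {W..}"
    by (simp add: vimage_def atLeast_def s'_a)
  then have a_Int: "{0..<W + w a} \<inter> s' -` {a} = {W..<W + w a}"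
    using W by auto
  have b: "s' -` {b} = {..<W} \<inter> s -` {b}" if "b \<in> F" for b
    using s'_b[OF that] by (simp add: vimage_def lessThan_def Int_def)
  have Int_W: "{0..<W + w a} \<inter> ({..<W} \<inter> X) = {0..<W} \<inter> X" for X
    using W by auto
  show ?case
  proof (intro exI[of _ s'] conjI allI ballI)
    show "s' t \<in> insert a F" for t
      using s(1) by (simp add: s'_def)
    fix c assume c: "c \<in> insert a F"
    show "s' -` {c} \<in> sets borel"
    proof (cases "c = a")
      case False
      with c have "c \<in> F" by simp
      then show ?thesis unfolding b[OF \<open>c \<in> F\<close>] using s(2) by auto
    qed (simp add: a)
    show "measure lebesgue ({0..<sum w (insert a F)} \<inter> s' -` {c}) = w c"
    proof (cases "c = a")
      case True
      then show ?thesis unfolding True sum_insert a_Int using W by simp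
    next
      case False
      with c have "c \<in> F" by simp
      then show ?thesis unfolding sum_insert b[OF \<open>c \<in> F\<close>] Int_W using s(3) by simp
    qed
  qed
qed

text \<open>The fibres of \<open>h\<close> are the classes. Up to the point 0, the fractional parts
  of the preimage of \<open>I\<close> are the \<open>t\<close> in the unit interval whose selected
  set meets \<open>I\<close>: values of \<open>h\<close> lie in that set, and each of its elements
  \<open>i\<close> is attained at \<open>t + real i\<close>.\<close>

lemma borel_partition_Phi:
  fixes V :: "nat set" and w :: "nat set \<Rightarrow> real"
  assumes fin: "finite V" and ne: "V \<noteq> {}"
    and w: "\<And>S. S \<subseteq> V \<Longrightarrow> S \<noteq> {} \<Longrightarrow> w S \<ge> 0"
    and sum1: "sum w (Pow V - {{}}) = 1"
  obtains h :: "real \<Rightarrow> nat" where "h \<in> borel \<rightarrow>\<^sub>M count_space UNIV" "range h = V"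
    "\<And>I. Phi (h -` I) = (\<Sum>S | S \<subseteq> V \<and> S \<inter> I \<noteq> {}. w S)"
proof -
  let ?F = "Pow V - {{}}"
  have finF: "finite ?F" and neF: "?F \<noteq> {}"
    using fin ne by auto
  have "\<And>S. S \<in> ?F \<Longrightarrow> w S \<ge> 0"
    using w by blast
  from borel_selector_with_lengths[of ?F w, OF finF neF this, unfolded sum1]
  obtain s :: "real \<Rightarrow> nat set" where "(\<forall>t. s t \<in> ?F) \<and> (\<forall>S\<in>?F.
    s -` {S} \<in> sets borel \<and> measure lebesgue ({0..<1} \<inter> s -` {S}) = w S)" ..
  then have s: "\<And>t. s t \<in> ?F" "\<And>S. S \<in> ?F \<Longrightarrow> s -` {S} \<in> sets borel"
    "\<And>S. S \<in> ?F \<Longrightarrow> measure lebesgue ({0..<1} \<inter> s -` {S}) = w S"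
    by blast+
  \<comment> \<open>The default \<open>Min S\<close> keeps the value in \<open>S\<close> when the
    integer part of \<open>x\<close> is not an element of it.\<close>
  define g where "g S x = (if nat \<lfloor>x\<rfloor> \<in> S then nat \<lfloor>x\<rfloor> else Min S)" for S and x :: real
  \<comment> \<open>The exception for \<open>x \<in> V\<close> makes every class nonempty, even one that must have
    measure zero; it changes the images under \<^const>\<open>frac\<close> only at \<open>0\<close>.\<close>
  define h where "h x = (if x \<in> real ` V then nat \<lfloor>x\<rfloor> else g (s (frac x)) x)" for x
  have g_in: "g S x \<in> S" if "S \<in> ?F" for S x
    using that fin by (auto simp: g_def intro!: Min_in intro: finite_subset)
  have sV: "s t \<subseteq> V" for t
    using s(1)[of t] by auto
  have h_real: "h (real i) = i" if "i \<in> V" for i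
    using that by (simp add: h_def)
  have h_in: "h x \<in> s (frac x)" if "x \<notin> real ` V" for x
    using that g_in[OF s(1)] by (simp add: h_def)
  show thesis
  proof
    have [measurable]: "s \<in> borel \<rightarrow>\<^sub>M count_space ?F"
      using s(1,2) by (subst measurable_count_space_eq2[OF finF]) auto
    \<comment> \<open>Since \<open>s (frac x)\<close> takes finitely many values, measurability of
      \<open>g S\<close> for each fixed \<open>S\<close> suffices.\<close>
    have "g S \<in> borel \<rightarrow>\<^sub>M count_space UNIV" for S
      using measurable_compose[OF measurable_real_floor,
          of "\<lambda>z. if nat z \<in> S then nat z else Min S" "count_space UNIV"]
      by (simp add: g_def[abs_def])
    moreover have "(\<lambda>x. s (frac x)) \<in> borel \<rightarrow>\<^sub>M count_space ?F"
      by measurable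
    ultimately have [measurable]: "(\<lambda>x. g (s (frac x)) x) \<in> borel \<rightarrow>\<^sub>M count_space UNIV"
      using countable_finite[OF finF]
      by (rule measurable_compose_countable'[where f = g and g = "\<lambda>x. s (frac x)"])
    have [measurable]: "real ` V \<in> sets borel"
      using fin by (intro borel_closed finite_imp_closed) auto
    have [measurable]: "(\<lambda>x::real. nat \<lfloor>x\<rfloor>) \<in> borel \<rightarrow>\<^sub>M count_space UNIV"
      using measurable_compose[OF measurable_real_floor, of nat "count_space UNIV"] by simp
    show h: "h \<in> borel \<rightarrow>\<^sub>M count_space UNIV"
      unfolding h_def[abs_def] by measurable
    show "range h = V"
    proof
      show "range h \<subseteq> V"
      proof (rule image_subsetI)
        fix x
        show "h x \<in> V"
          using h_in[of x] sV[of "frac x"] by (cases "x \<in> real ` V") (auto simp: h_real)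
      qed
      show "V \<subseteq> range h"
        using h_real by (metis range_eqI subsetI)
    qed
    fix I :: "nat set"
    let ?G = "{S. S \<subseteq> V \<and> S \<inter> I \<noteq> {}}"
    let ?U = "\<Union>S\<in>?G. {0..<1} \<inter> s -` {S}"
    have G: "?G \<subseteq> ?F" "finite ?G"
      using finF by (auto intro: rev_finite_subset)
    have hI: "h -` I \<in> sets borel"
      using measurable_sets[OF h, of I] by simp
    have piece: "{0..<1} \<inter> s -` {S} \<in> fmeasurable lebesgue" if "S \<in> ?G" for S
    proof (rule fmeasurableI2)
      show "{0..1::real} \<in> fmeasurable lebesgue" by simp
      show "{0..<1} \<inter> s -` {S} \<subseteq> {0..1}" by auto
      have "s -` {S} \<in> sets borel"
        using that G(1) by (intro s(2)) blast
      then have "{0..<1} \<inter> s -` {S} \<in> sets borel"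
        by (intro sets.Int) simp_all
      then show "{0..<1} \<inter> s -` {S} \<in> sets lebesgue"
        by (simp add: sets_completionI_sets)
    qed
    have "t \<in> frac ` (h -` I)" if "t \<in> ?U" "t \<noteq> 0" for t
    proof -
      obtain i where i: "0 \<le> t" "t < 1" "i \<in> s t" "i \<in> I"
        using \<open>t \<in> ?U\<close> by auto
      have fl: "\<lfloor>t + real i\<rfloor> = int i" and fr: "frac (t + real i) = t"
        using i by (simp_all add: floor_eq_iff frac_unique_iff)
      \<comment> \<open>As \<open>t \<noteq> 0\<close>, this point is not an integer, so
        \<open>h\<close> follows \<open>g\<close> there, and the floor \<open>i\<close> selects
        \<open>i\<close> itself.\<close>
      have "t + real i \<notin> real ` V"
        using fr \<open>t \<noteq> 0\<close> by (metis Ints_of_nat frac_eq_0_iff image_iff)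
      then have "h (t + real i) = i"
        using fl fr i by (simp add: h_def g_def)
      then show ?thesis
        using fr i(4) by (metis imageI vimageI)
    qed
    moreover have "t \<in> ?U" if "t \<in> frac ` (h -` I)" "t \<noteq> 0" for t
    proof -
      obtain x where x: "h x \<in> I" "t = frac x"
        using \<open>t \<in> frac ` (h -` I)\<close> by auto
      then have "x \<notin> real ` V"
        using \<open>t \<noteq> 0\<close> by auto
      then have "s t \<inter> I \<noteq> {}"
        using h_in x by blast
      moreover have "t \<in> {0..<1}"
        using x(2) by (simp add: frac_lt_1)
      ultimately show ?thesis
        using sV by blast
    qed
    ultimately have iff: "t \<in> frac ` (h -` I) \<longleftrightarrow> t \<in> ?U" if "t \<noteq> 0" for t
      using that by (intro iffI)
    \<comment> \<open>Adjoining the null point 0 turns agreement away from 0 into an equality and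
      leaves both measures unchanged.\<close>
    have eq: "frac ` (h -` I) \<union> {0} = ?U \<union> {0}"
    proof (rule set_eqI)
      show "t \<in> frac ` (h -` I) \<union> {0} \<longleftrightarrow> t \<in> ?U \<union> {0}" for t
        using iff[of t] by (cases "t = 0") (simp_all only: Un_iff singleton_iff simp_thms)
    qed
    have null: "{0::real} \<in> null_sets lebesgue"
      by simp
    have "Phi (h -` I) = measure lebesgue (frac ` (h -` I) \<union> {0})"
      unfolding Phi_def
      by (rule measure_Un_null_set[symmetric, OF fmeasurableD[OF frac_image_fmeasurable[OF hI]] null])
    also have "\<dots> = measure lebesgue ?U"
      unfolding eq
      by (intro measure_Un_null_set null sets.finite_UN G(2) fmeasurableD piece)
    also have "\<dots> = (\<Sum>S\<in>?G. measure lebesgue ({0..<1} \<inter> s -` {S}))"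
    proof (rule measure_UNION'[OF G(2) piece])
      show "pairwise (\<lambda>S T. disjnt ({0..<1} \<inter> s -` {S}) ({0..<1} \<inter> s -` {T})) ?G"
        by (intro pairwiseI) (auto simp: disjnt_iff)
    qed
    also have "\<dots> = sum w ?G"
      using G(1) by (intro sum.cong s(3)) blast+
    finally show "Phi (h -` I) = sum w ?G" .
  qed
qed

theorem theorem4p6:
  "coverage_function (UNIV :: real set) (sets borel) Phi \<and>
   Phi UNIV = 1 \<and>
   (\<forall>(q::nat) (\<psi> :: nat set \<Rightarrow> real).
      q \<ge> 1 \<longrightarrow> coverage_function {1..q} (Pow {1..q}) \<psi> \<longrightarrow> \<psi> {1..q} = 1 \<longrightarrow>
      (\<exists>Q :: nat \<Rightarrow> real set.
         (\<forall>i\<in>{1..q}. Q i \<in> sets borel \<and> Q i \<noteq> {}) \<and>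
         disjoint_family_on Q {1..q} \<and>
         (\<Union>i\<in>{1..q}. Q i) = UNIV \<and>
         (\<forall>I. I \<subseteq> {1..q} \<longrightarrow> \<psi> I = Phi (\<Union>i\<in>I. Q i))))"
proof (intro conjI allI impI coverage_function_Phi Phi_UNIV)
  fix q :: nat and \<psi> :: "nat set \<Rightarrow> real"
  let ?V = "{1..q}"
  assume q: "q \<ge> 1" and cov: "coverage_function ?V (Pow ?V) \<psi>" and \<psi>1: "\<psi> ?V = 1"
  obtain w where w: "\<And>S. S \<subseteq> ?V \<Longrightarrow> S \<noteq> {} \<Longrightarrow> w S \<ge> (0::real)"
    and \<psi>: "\<And>I. I \<subseteq> ?V \<Longrightarrow> \<psi> I = (\<Sum>S | S \<subseteq> ?V \<and> S \<inter> I \<noteq> {}. w S)"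
    by (rule coverage_function_weights[OF cov finite_atLeastAtMost]) (rule that)
  \<comment> \<open>Every nonempty subset meets \<open>?V\<close>, so \<open>\<psi> ?V = 1\<close>
    makes the weights of the nonempty sets sum to 1: the intervals fill the unit interval
    exactly.\<close>
  have "{S. S \<subseteq> ?V \<and> S \<inter> ?V \<noteq> {}} = Pow ?V - {{}}"
    by auto
  then have sum1: "sum w (Pow ?V - {{}}) = 1"
    using \<psi>[OF order_refl] \<psi>1 by simp
  have V: "?V \<noteq> {}"
    using q by auto
  obtain h :: "real \<Rightarrow> nat" where h: "h \<in> borel \<rightarrow>\<^sub>M count_space UNIV" "range h = ?V"
    "\<And>I. Phi (h -` I) = (\<Sum>S | S \<subseteq> ?V \<and> S \<inter> I \<noteq> {}. w S)"
    by (rule borel_partition_Phi[OF finite_atLeastAtMost V w sum1]) (assumption | rule that)+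
  show "\<exists>Q :: nat \<Rightarrow> real set.
      (\<forall>i\<in>?V. Q i \<in> sets borel \<and> Q i \<noteq> {}) \<and>
      disjoint_family_on Q ?V \<and>
      (\<Union>i\<in>?V. Q i) = UNIV \<and>
      (\<forall>I. I \<subseteq> ?V \<longrightarrow> \<psi> I = Phi (\<Union>i\<in>I. Q i))"
  proof (intro exI[of _ "\<lambda>i. h -` {i}"] conjI ballI allI impI)
    fix i assume i: "i \<in> ?V"
    show "h -` {i} \<in> sets borel"
      using measurable_sets[OF h(1), of "{i}"] by simp
    have "i \<in> range h"
      using i h(2) by simp
    then show "h -` {i} \<noteq> {}"
      by auto
  next
    show "disjoint_family_on (\<lambda>i. h -` {i}) ?V"
      by (auto simp: disjoint_family_on_def)
    show "(\<Union>i\<in>?V. h -` {i}) = UNIV"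
      using h(2) by auto
    fix I assume "I \<subseteq> ?V"
    then show "\<psi> I = Phi (\<Union>i\<in>I. h -` {i})"
      unfolding vimage_eq_UN[of h I, symmetric] h(3) by (rule \<psi>)
  qed
qed

end
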